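(* For even integers $T\ge 4$ and even $a$ with $2\le a\le T-2$ write $$N_T(a)=E_c(C_a^-)+E_c(C_{T-a}^-),\qquad P_T(a)=E_c(C_a^+)+E_c(C_{T-a}^+),$$ and let $M(T)$ be the largest even integer not exceeding $T/2$. Parts (i)–(iv) (the case $n\ge 22$): Let $n\ge 22$ and put $N=n$ if $n$ is even and $N=n-1$ if $n$ is odd. For each even $T$ with $22\le T\le N$ let $B(T)$ denote the chain $$P_T(M(T))>P_T(M(T)-2)>\cdots>P_T(6)>N_{T-2}(2)>P_T(4)>N_{T-2}(4)>N_{T-2}(6)>\cdots>N_{T-2}(M(T-2))>P_T(2),$$ the ellipses running over consecutive even arguments. Then the strict chain $$N_N(2)>N_N(4)>\cdots>N_N(M(N))>B(N)>B(N-2)>\cdots>B(22)$$ holds, where "$B(T)>B(T-2)$" means that the chain $B(T)$ is followed by the chain $B(T-2)$, its last element $P_T(2)$ being strictly greater than the first element $P_{T-2}(M(T-2))$ of $B(T-2)$ (and $N_N(M(N))>P_N(M(N))$). Part (v) (the case $n\le 22$): the following chain holds: $E_c(C_2^+)+E_c(C_{20}^+)>E_c(C_{10}^+)+E_c(C_{10}^+)>E_c(C_8^+)+E_c(C_{12}^+)>E_c(C_2^-)+E_c(C_{16}^-)>E_c(C_6^+)+E_c(C_{14}^+)>E_c(C_4^+)+E_c(C_{16}^+)>E_c(C_4^-)+E_c(C_{14}^-)>E_c(C_6^-)+E_c(C_{12}^-)>E_c(C_8^-)+E_c(C_{10}^-)>E_c(C_2^+)+E_c(C_{18}^+)>E_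c(C_2^-)+E_c(C_{14}^-)>E_c(C_8^+)+E_c(C_{10}^+)>E_c(C_6^+)+E_c(C_{12}^+)>E_c(C_4^+)+E_c(C_{14}^+)>E_c(C_4^-)+E_c(C_{12}^-)>E_c(C_6^-)+E_c(C_{10}^-)>E_c(C_8^-)+E_c(C_8^-)>E_c(C_2^+)+E_c(C_{16}^+)>E_c(C_2^-)+E_c(C_{12}^-)>E_c(C_8^+)+E_c(C_8^+)>E_c(C_6^+)+E_c(C_{10}^+)>E_c(C_4^+)+E_c(C_{12}^+)>E_c(C_4^-)+E_c(C_{10}^-)>E_c(C_6^-)+E_c(C_8^-)>E_c(C_2^+)+E_c(C_{14}^+)>E_c(C_2^-)+E_c(C_{10}^-)>E_c(C_6^+)+E_c(C_8^+)>E_c(C_4^+)+E_c(C_{10}^+)>E_c(C_4^-)+E_c(C_8^-)>E_c(C_6^-)+E_c(C_6^-)>E_c(C_2^+)+E_c(C_{12}^+)>E_c(C_2^-)+E_c(C_8^-)>E_c(C_6^+)+E_c(C_6^+)>E_c(C_4^+)+E_c(C_8^+)=E_c(C_4^-)+E_c(C_6^-)>E_c(C_2^+)+E_c(C_{10}^+)>E_c(C_2^-)+E_c(C_6^-)>E_c(C_4^-)+E_c(C_4^-)>E_c(C_4^+)+E_c(C_6^+)>E_c(C_2^+)+E_c(C_8^+)=E_c(C_2^-)+E_c(C_4^-)>E_c(C_4^+)+E_c(C_4^+)=E_c(C_2^-)+E_c(C_2^-)>E_c(C_2^+)+E_c(C_6^+)>E_c(C_2^+)+E_c(C_4^+)>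E_c(C_2^+)+E_c(C_2^+).$
   Context: For an integer $k\ge 2$, $C_k^+$ (resp. $C_k^-$) denotes a signed directed cycle on $k$ vertices $v_1,\dots,v_k$ with arcs $v_1v_2,\dots,v_{k-1}v_k,v_kv_1$, each arc carrying a sign $\pm1$, such that the product of the signs is $+1$ (resp. $-1$). Its adjacency matrix $A=(a_{ij})$ has $a_{ij}=\sigma(v_iv_j)$ if $v_iv_j$ is an arc and $0$ otherwise. The iota energy of a signed digraph with adjacency eigenvalues $z_1,\dots,z_k$ is $E_c=\sum_{j=1}^k|\mathrm{Im}(z_j)|$. Thus $E_c(C_k^+)=\sum_{j=0}^{k-1}|\sin\frac{2j\pi}{k}|$ and $E_c(C_k^-)=\sum_{j=0}^{k-1}|\sin\frac{(2j+1)\pi}{k}|$. The sums $E_c(C_a^\pm)+E_c(C_b^\pm)$ are the iota energies of the bicyclic signed digraphs on $n$ vertices whose only directed cycles are two vertex-disjoint cycles $C_a^\pm$, $C_b^\pm$ of even lengths $a,b$ (with $a+b\le n$), both positive or both negative. *)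

theory Defs
  imports "Jordan_Normal_Form.Char_Poly"
    "HOL-Computational_Algebra.Fundamental_Theorem_Algebra"
begin

text \<open>
  Signed digraphs have vertex set \<open>{0..<nverts G}\<close>. The field \<open>arc_sign G\<close> is
  relevant only on \<open>arc_set G\<close>.
\<close>

record signed_digraph =
  nverts :: nat
  arc_set :: "(nat \<times> nat) set"
  arc_sign :: "nat \<times> nat \<Rightarrow> int"

text \<open>
  \<open>signed_cycle k \<epsilon> G\<close>: \<open>G\<close> is a signed directed cycle \<open>C\<^sub>k\<close> whose arc signs have product
  \<open>\<epsilon>\<close>; the vertex \<open>v\<^sub>i\<close> (for \<open>1 \<le> i \<le> k\<close>) is represented by \<open>i - 1\<close>.
  The signs of the individual arcs are not prescribed.
\<close>

definition signed_cycle :: "nat \<Rightarrow> int \<Rightarrow> signed_digraph \<Rightarrow> bool" where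
  "signed_cycle k \<epsilon> G \<longleftrightarrow>
     nverts G = k \<and>
     arc_set G = {(i, Suc i mod k) | i. i < k} \<and>
     (\<forall>e\<in>arc_set G. arc_sign G e \<in> {1, -1}) \<and>
     (\<Prod>e\<in>arc_set G. arc_sign G e) = \<epsilon>"

definition adjacency_matrix :: "signed_digraph \<Rightarrow> complex mat" where
  "adjacency_matrix G =
     mat (nverts G) (nverts G)
       (\<lambda>(i, j). if (i, j) \<in> arc_set G then of_int (arc_sign G (i, j)) else 0)"

text \<open>Eigenvalues are counted with algebraic multiplicity.\<close>

definition iota_energy :: "signed_digraph \<Rightarrow> real" ("E\<^sub>c") where
  "E\<^sub>c G = (\<Sum>z\<in>#proots (char_poly (adjacency_matrix G)). \<bar>Im z\<bar>)"

text \<open>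
  For a family \<open>C\<close> of positive (negative) cycles, \<open>energy_sum C T a\<close> is
  \<open>P\<^sub>T(a)\<close> (respectively \<open>N\<^sub>T(a)\<close>).
\<close>

definition energy_sum :: "(nat \<Rightarrow> signed_digraph) \<Rightarrow> nat \<Rightarrow> nat \<Rightarrow> real" where
  "energy_sum C T a = E\<^sub>c (C a) + E\<^sub>c (C (T - a))"

definition M :: "nat \<Rightarrow> nat" where
  "M T = (GREATEST m. even m \<and> real m \<le> real T / 2)"

definition evens :: "nat \<Rightarrow> nat \<Rightarrow> nat list" where
  "evens l u = filter even [l..<Suc u]"

text \<open>The terms of the chain \<open>B(T)\<close>, in the order in which they are claimed to decrease.\<close>

definition chain_B ::
    "(nat \<Rightarrow> signed_digraph) \<Rightarrow> (nat \<Rightarrow> signed_digraph) \<Rightarrow> nat \<Rightarrow> real list" where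
  "chain_B Cp Cm T =
     map (energy_sum Cp T) (rev (evens 6 (M T))) @
     [energy_sum Cm (T - 2) 2, energy_sum Cp T 4] @
     map (energy_sum Cm (T - 2)) (evens 4 (M (T - 2))) @
     [energy_sum Cp T 2]"

end

theory Submission
  imports Defs
begin

text \<open>
  The eigenvalues of a signed cycle are the \<open>k\<close>-th roots of \<open>\<plusminus>1\<close>, so for even \<open>k\<close> the energies are
  \<open>2 cot(\<pi>/k)\<close> (positive cycle) and \<open>2 csc(\<pi>/k)\<close> (negative cycle). As functions of real \<open>k \<ge> 2\<close>
  these are strictly concave and strictly convex, respectively, which orders the sums with a fixed
  \<open>T\<close>. The transitions between the pieces of the chain follow from \<open>cot x < 1/x < csc x\<close> and from
  \<open>cot x = 1/x - x/3 - O(x\<^sup>3)\<close>, \<open>csc x = 1/x + x/6 + O(x\<^sup>3)\<close> with explicit constants; the tightest one,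
  \<open>P\<^sub>T(6) > N\<^bsub>T-2\<^esub>(2)\<close>, amounts to \<open>\<surd>3 - 1 > 2/\<pi> + O(1/T)\<close>.
\<close>

section \<open>The spectrum of a signed cycle\<close>

lemma signed_cycle_adjacency_mult:
  assumes G: "signed_cycle k \<epsilon> G" and v: "v \<in> carrier_vec k" and i: "i < k"
  shows "(adjacency_matrix G *\<^sub>v v) $ i = of_int (arc_sign G (i, Suc i mod k)) * v $ (Suc i mod k)"
proof -
  have n: "nverts G = k" and arcs: "arc_set G = {(i, Suc i mod k) |i. i < k}"
    using G by (auto simp: signed_cycle_def)
  have "(adjacency_matrix G *\<^sub>v v) $ i =
      (\<Sum>j<k. (if (i, j) \<in> arc_set G then of_int (arc_sign G (i, j)) else 0) * v $ j)"
    using i v by (simp add: adjacency_matrix_def n scalar_prod_def lessThan_atLeast0)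
  also have "\<dots> = (\<Sum>j<k. if j = Suc i mod k then of_int (arc_sign G (i, j)) * v $ j else 0)"
    using i by (intro sum.cong) (auto simp: arcs)
  also have "\<dots> = of_int (arc_sign G (i, Suc i mod k)) * v $ (Suc i mod k)"
    using i by (subst sum.delta) auto
  finally show ?thesis .
qed

text \<open>An eigenvector for \<open>z\<close> is obtained by going around the cycle; the walk closes up because
  \<open>z ^ k\<close> is the product of all signs.\<close>

lemma signed_cycle_eigenvalue:
  assumes G: "signed_cycle k \<epsilon> G" and k: "k > 0" and z: "z ^ k = of_int \<epsilon>"
  shows "eigenvalue (adjacency_matrix G) z"
proof -
  define s :: "nat \<Rightarrow> complex" where "s i = of_int (arc_sign G (i, Suc i mod k))" for i
  define p where "p i = (\<Prod>j<i. s j)" for i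
  \<comment> \<open>Solving \<open>s i * v (i + 1) = z * v i\<close> would divide by the signs;
    signs are their own inverses, so their partial products \<open>p i\<close> serve
    instead.\<close>
  define v where "v = vec k (\<lambda>i. z ^ i * p i)"
  have n: "nverts G = k" and arcs: "arc_set G = {(i, Suc i mod k) |i. i < k}"
    and sgn: "\<And>e. e \<in> arc_set G \<Longrightarrow> arc_sign G e \<in> {1, -1}"
    and prod: "(\<Prod>e\<in>arc_set G. arc_sign G e) = \<epsilon>"
    using G by (auto simp: signed_cycle_def)
  have s: "s i * s i = 1" if "i < k" for i
    using sgn[of "(i, Suc i mod k)"] that by (auto simp: arcs s_def)
  have "arc_set G = (\<lambda>i. (i, Suc i mod k)) ` {..<k}"
    by (auto simp: arcs)
  hence "of_int \<epsilon> = (\<Prod>e\<in>(\<lambda>i. (i, Suc i mod k)) ` {..<k}. of_int (arc_sign G e) :: complex)"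
    by (simp add: prod [symmetric])
  also have "\<dots> = p k"
    by (subst prod.reindex) (auto simp: inj_on_def p_def s_def)
  finally have p: "of_int \<epsilon> = p k" .
  have p2: "p i * p i = 1" if "i \<le> k" for i
    using that s by (simp add: p_def flip: prod.distrib)
  have closing: "s i * v $ (Suc i mod k) = z * v $ i" if "i < k" for i
  proof (cases "Suc i = k")
    case True
    have "z * (z ^ i * p i) = z ^ k * p i"
      using True by auto
    also have "\<dots> = s i"
      using p2[of i] True by (auto simp: z p p_def algebra_simps)
    finally show ?thesis
      using True k by (auto simp: v_def p_def)
  next
    case False
    hence "Suc i < k" using that by simp
    have "s i * p (Suc i) = p i"
      using s[OF that] by (simp add: p_def algebra_simps)
    hence "s i * (z ^ Suc i * p (Suc i)) = z * (z ^ i * p i)"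
      by (simp add: algebra_simps)
    thus ?thesis
      using \<open>Suc i < k\<close> that by (simp add: v_def del: power_Suc)
  qed
  have vk: "v \<in> carrier_vec k" by (simp add: v_def)
  have "v $ 0 = 1" using k by (simp add: v_def p_def)
  hence "v \<noteq> 0\<^sub>v k" using k by auto
  moreover have "adjacency_matrix G *\<^sub>v v = z \<cdot>\<^sub>v v"
  proof (rule eq_vecI)
    fix i assume "i < dim_vec (z \<cdot>\<^sub>v v)"
    hence i: "i < k" by (simp add: v_def)
    show "(adjacency_matrix G *\<^sub>v v) $ i = (z \<cdot>\<^sub>v v) $ i"
      using signed_cycle_adjacency_mult[OF G vk i] closing[OF i] i vk by (simp add: s_def)
  qed (simp add: adjacency_matrix_def n v_def)
  ultimately show ?thesis
    using vk unfolding eigenvalue_def eigenvector_def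
    by (intro exI[of _ v]) (simp add: adjacency_matrix_def n)
qed

text \<open>Counting replaces a computation of the characteristic polynomial: its degree is
  \<open>k\<close>, and the \<open>k\<close> distinct solutions of
  \<open>z ^ k = of_int \<epsilon>\<close> are all roots of it. Hence every root is simple and there
  are no others.\<close>

lemma iota_energy_signed_cycle:
  assumes G: "signed_cycle k \<epsilon> G" and k: "k > 0" and \<epsilon>: "\<epsilon> \<noteq> 0"
  shows "E\<^sub>c G = (\<Sum>z | z ^ k = of_int \<epsilon>. \<bar>Im z\<bar>)"
proof -
  let ?A = "adjacency_matrix G" and ?R = "{z::complex. z ^ k = of_int \<epsilon>}"
  have A: "?A \<in> carrier_mat k k"
    using G by (simp add: adjacency_matrix_def signed_cycle_def)
  have deg: "degree (char_poly ?A) = k" "char_poly ?A \<noteq> 0"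
    using degree_monic_char_poly[OF A] k by auto
  have card: "card ?R = k"
    using k \<epsilon> by (intro card_nth_roots) auto
  have fin: "finite ?R"
    using card k by (metis card.infinite less_irrefl)
  have "mset_set ?R \<subseteq># proots (char_poly ?A)"
  proof (rule mset_subset_eqI)
    fix z
    show "count (mset_set ?R) z \<le> count (proots (char_poly ?A)) z"
    proof (cases "z \<in> ?R")
      case True
      hence "poly (char_poly ?A) z = 0"
        using signed_cycle_eigenvalue[OF G k] eigenvalue_root_char_poly[OF A] by simp
      hence "order z (char_poly ?A) > 0"
        using deg(2) by (simp add: order_gt_0_iff)
      thus ?thesis using True deg fin by simp
    qed simp
  qed
  moreover have "size (proots (char_poly ?A)) \<le> size (mset_set ?R)"
    using deg card by (simp add: size_proots_complex)
  ultimately have "proots (char_poly ?A) = mset_set ?R"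
    by (metis mset_subset_size not_le subset_mset.less_le)
  thus ?thesis
    by (simp add: iota_energy_def sum_unfold_sum_mset)
qed

section \<open>Sine sums and closed forms of the energies\<close>

text \<open>The factor \<open>2 * sin (x / 2)\<close> turns each summand into a difference of two
  cosines, and the sum telescopes.\<close>

lemma sum_sin_arith_progression:
  fixes a x :: real
  shows "2 * sin (x / 2) * (\<Sum>j<m. sin (a + real j * x)) = cos (a - x / 2) - cos (a + (real m - 1 / 2) * x)"
proof (induction m)
  case 0
  show ?case by (simp add: algebra_simps)
next
  case (Suc m)
  have "2 * sin (x / 2) * sin (a + real m * x) = cos (a + (real m - 1 / 2) * x) - cos (a + (real m + 1 / 2) * x)"
    using cos_diff[of "a + real m * x" "x / 2"] cos_add[of "a + real m * x" "x / 2"]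
    by (simp add: algebra_simps)
  with Suc show ?case by (simp add: algebra_simps)
qed

text \<open>Advancing the index by \<open>m\<close> adds pi to the angle, which leaves the absolute
  value unchanged, so the second half of the sum repeats the first. In the first half the bounds on
  \<open>b\<close> keep all angles in [0, pi], where the sine is nonnegative.\<close>

lemma sum_abs_sin_half_period:
  fixes b x :: real
  assumes m: "m > 0" and x: "x = pi / real m" and b: "0 \<le> b" "b \<le> x"
  shows "(\<Sum>j<2*m. \<bar>sin (b + real j * x)\<bar>) = 2 * (\<Sum>j<m. sin (b + real j * x))"
proof -
  have mx: "real m * x = pi" using m by (simp add: x)
  have nonneg: "0 \<le> sin (b + real j * x)" if "j < m" for j
  proof (rule sin_ge_zero)
    have "b + real j * x \<le> (real j + 1) * x" using b by (simp add: algebra_simps)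
    also have "\<dots> \<le> real m * x" using that by (intro mult_right_mono) (auto simp: x)
    finally show "b + real j * x \<le> pi" using mx by simp
  qed (use b x in auto)
  have split: "(\<Sum>j<m + n. f j) = (\<Sum>j<m. f j) + (\<Sum>j<n. f (m + j))" for f :: "nat \<Rightarrow> real" and n
    by (induction n) auto
  have "(\<Sum>j<2*m. \<bar>sin (b + real j * x)\<bar>) =
      (\<Sum>j<m. \<bar>sin (b + real j * x)\<bar>) + (\<Sum>j<m. \<bar>sin (b + real (m + j) * x)\<bar>)"
    unfolding mult_2 by (rule split)
  also have "(\<Sum>j<m. \<bar>sin (b + real (m + j) * x)\<bar>) = (\<Sum>j<m. \<bar>sin (b + real j * x)\<bar>)"
  proof (rule sum.cong)
    fix j assume "j \<in> {..<m}"
    have "b + real (m + j) * x = (b + real j * x) + pi" by (simp add: algebra_simps flip: mx)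
    thus "\<bar>sin (b + real (m + j) * x)\<bar> = \<bar>sin (b + real j * x)\<bar>" by (simp only: sin_periodic_pi abs_minus_cancel)
  qed simp
  also have "(\<Sum>j<m. \<bar>sin (b + real j * x)\<bar>) = (\<Sum>j<m. sin (b + real j * x))"
    using nonneg by (intro sum.cong) auto
  finally show ?thesis by simp
qed

text \<open>Both signs are treated at once: \<open>b\<close> is the angle of one root on the unit
  circle, namely 0 for the positive cycle and pi/k for the negative one, and the other roots arise
  by rotation through multiples of 2 pi/k.\<close>

lemma iota_energy_cycle_even:
  assumes G: "signed_cycle k \<epsilon> G" and k: "even k" "k > 0"
    and \<epsilon>: "of_int \<epsilon> = cis (real k * b)" and b: "0 \<le> b" "b \<le> 2 * pi / real k"
  shows "E\<^sub>c G = 2 * cos (b - pi / real k) / sin (pi / real k)"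
proof -
  obtain m where m: "k = 2 * m" using k by auto
  have m0: "m > 0" using k m by auto
  define x where "x = pi / real m"
  have x: "2 * pi / real k = x" "pi / real k = x / 2" "real m * x = pi" using m0 by (auto simp: m x_def)
  have bij: "bij_betw (\<lambda>j. cis b * cis (2 * pi * real j / real k)) {..<k} {z. z ^ k = of_int \<epsilon>}"
  proof -
    have "bij_betw (\<lambda>z. cis b * z) {z. z ^ k = 1} {z. z ^ k = of_int \<epsilon>}"
    proof (rule bij_betwI[where g = "\<lambda>z. cis (-b) * z"])
      show "(\<lambda>z. cis b * z) \<in> {z. z ^ k = 1} \<rightarrow> {z. z ^ k = of_int \<epsilon>}"
        by (auto simp: power_mult_distrib DeMoivre \<epsilon>)
      show "(\<lambda>z. cis (-b) * z) \<in> {z. z ^ k = of_int \<epsilon>} \<rightarrow> {z. z ^ k = 1}"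
        by (auto simp: power_mult_distrib DeMoivre \<epsilon> cis_mult)
    qed (auto simp: cis_mult simp flip: mult.assoc)
    from bij_betw_trans[OF bij_betw_roots_unity[OF k(2)] this]
    show ?thesis by (simp add: o_def)
  qed
  have "E\<^sub>c G = (\<Sum>z | z ^ k = of_int \<epsilon>. \<bar>Im z\<bar>)"
    using \<epsilon> by (intro iota_energy_signed_cycle[OF G k(2)]) (metis cis_neq_zero of_int_0)
  also have "\<dots> = (\<Sum>j<2*m. \<bar>sin (b + real j * x)\<bar>)"
    by (subst sum.reindex_bij_betw[OF bij, symmetric], unfold m)
      (intro sum.cong, auto simp: cis_mult x_def mult.commute)
  also have "\<dots> = 2 * (\<Sum>j<m. sin (b + real j * x))"
    using b x by (intro sum_abs_sin_half_period[OF m0 x_def]) auto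
  finally have "sin (x / 2) * E\<^sub>c G = 2 * sin (x / 2) * (\<Sum>j<m. sin (b + real j * x))" by simp
  \<comment> \<open>The upper end of the telescoped sum is \<open>b + (m - 1/2) * x\<close>, and
    \<open>m * x = pi\<close>.\<close>
  also have "\<dots> = cos (b - x / 2) - cos ((b - x / 2) + pi)"
    unfolding sum_sin_arith_progression by (simp add: algebra_simps flip: x(3))
  also have "\<dots> = 2 * cos (b - x / 2)" by simp
  finally have "sin (x / 2) * E\<^sub>c G = 2 * cos (b - x / 2)" .
  moreover have "sin (x / 2) \<noteq> 0"
  proof -
    have "x / 2 < pi" "0 < x / 2" using m0 by (auto simp: x_def field_simps)
    thus ?thesis using sin_gt_zero[of "x/2"] by simp
  qed
  ultimately show ?thesis by (simp add: x field_simps)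
qed

corollary iota_energy_positive_cycle:
  assumes "signed_cycle k 1 G" "even k" "k > 0"
  shows "E\<^sub>c G = 2 * cot (pi / real k)"
  using iota_energy_cycle_even[OF assms, of 0] by (simp add: cot_def)

corollary iota_energy_negative_cycle:
  assumes "signed_cycle k (-1) G" "even k" "k > 0"
  shows "E\<^sub>c G = 2 / sin (pi / real k)"
  using iota_energy_cycle_even[OF assms, of "pi / real k"] assms by (simp add: field_simps)

section \<open>Cotangent and cosecant\<close>

text \<open>The remainder after the terms below \<open>n\<close> is at most
  \<open>x ^ n / fact n\<close>. For odd \<open>n\<close> this is the size of the next Taylor term,
  so \<open>n\<close> = 3, 5, 7, 9 give the alternating partial sums as bounds.\<close>

lemma sin_poly_bounds:
  fixes x :: real
  assumes "0 \<le> x"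
  shows "sin x \<le> x - x^3/6 + x^5/120" "sin x \<ge> x - x^3/6"
    and "sin x \<ge> x - x^3/6 + x^5/120 - x^7/5040"
    and "sin x \<le> x - x^3/6 + x^5/120 - x^7/5040 + x^9/362880"
proof -
  have *: "sin x \<le> (\<Sum>m<n. sin_coeff m * x ^ m) + x ^ n / fact n \<and>
      (\<Sum>m<n. sin_coeff m * x ^ m) - x ^ n / fact n \<le> sin x" for n
    using Maclaurin_sin_bound[of x n] assms by (auto simp: divide_inverse mult.commute abs_le_iff)
  have "(\<Sum>m<3. sin_coeff m * x ^ m) = x" "(\<Sum>m<5. sin_coeff m * x ^ m) = x - x^3/6"
    "(\<Sum>m<7. sin_coeff m * x ^ m) = x - x^3/6 + x^5/120"
    "(\<Sum>m<9. sin_coeff m * x ^ m) = x - x^3/6 + x^5/120 - x^7/5040"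
    by (simp_all add: sin_coeff_def lessThan_nat_numeral fact_numeral)
  thus "sin x \<le> x - x^3/6 + x^5/120" "sin x \<ge> x - x^3/6"
    and "sin x \<ge> x - x^3/6 + x^5/120 - x^7/5040"
    and "sin x \<le> x - x^3/6 + x^5/120 - x^7/5040 + x^9/362880"
    using *[of 3] *[of 5] *[of 7] *[of 9] by (simp_all add: fact_numeral)
qed

lemma cos_poly_bounds:
  fixes x :: real
  shows "cos x \<le> 1 - x^2/2 + x^4/24" and "cos x \<ge> 1 - x^2/2 + x^4/24 - x^6/720"
proof -
  have *: "cos x \<le> (\<Sum>m<n. cos_coeff m * x ^ m) + \<bar>x\<bar> ^ n / fact n \<and>
      (\<Sum>m<n. cos_coeff m * x ^ m) - \<bar>x\<bar> ^ n / fact n \<le> cos x" for n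
  proof -
    obtain t where "cos x = (\<Sum>m<n. cos_coeff m * x ^ m) + cos (t + 1/2 * real n * pi) / fact n * x ^ n"
      using Maclaurin_cos_expansion[of x n] by auto
    hence "\<bar>cos x - (\<Sum>m<n. cos_coeff m * x ^ m)\<bar> = \<bar>cos (t + 1/2 * real n * pi)\<bar> * (\<bar>x\<bar> ^ n / fact n)"
      by (simp add: abs_mult power_abs)
    also have "\<dots> \<le> 1 * (\<bar>x\<bar> ^ n / fact n)"
      by (intro mult_right_mono) auto
    finally show ?thesis by (auto simp: abs_le_iff)
  qed
  have "(\<Sum>m<4. cos_coeff m * x ^ m) = 1 - x^2/2"
    "(\<Sum>m<6. cos_coeff m * x ^ m) = 1 - x^2/2 + x^4/24"
    by (simp_all add: cos_coeff_def lessThan_nat_numeral fact_numeral)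
  thus "cos x \<le> 1 - x^2/2 + x^4/24" "cos x \<ge> 1 - x^2/2 + x^4/24 - x^6/720"
    using *[of 4] *[of 6]
    by (simp_all add: fact_numeral)
qed

text \<open>Since sin (pi/6) = 1/2 and the sine increases up to pi/2, it suffices to see on which
  side of 1/2 the sine lies at a rational point just below or just above pi/6.\<close>

lemma pi_bounds: "3.14159 < pi" "pi < 3.1416"
proof -
  have "sin 0.52359834 < (1/2::real)"
    by (rule le_less_trans[OF sin_poly_bounds(4)]) (simp_all add: power_divide eval_nat_numeral)
  hence "sin 0.52359834 < sin (pi / 6)" by (simp add: sin_30)
  hence "\<not> pi / 6 \<le> 0.52359834"
    using sin_monotone_2pi_le[of "pi / 6" "0.52359834"] pi_ge_two by auto
  thus "3.14159 < pi" by simp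
  have "sin 0.5236 > (1/2::real)"
    by (rule less_le_trans[OF _ sin_poly_bounds(3)]) (simp_all add: power_divide eval_nat_numeral)
  hence "sin 0.5236 > sin (pi / 6)" by (simp add: sin_30)
  hence "\<not> pi / 6 \<ge> 0.5236"
    using sin_monotone_2pi_le[of "0.5236" "pi / 6"] pi_ge_two by auto
  thus "pi < 3.1416" by simp
qed

section \<open>Concavity of cot (pi/x) and convexity of csc (pi/x)\<close>

lemma x_cos_less_sin:
  fixes x :: real
  assumes "0 < x" "x \<le> pi"
  shows "x * cos x < sin x"
proof -
  define f where "f x = sin x - x * cos x" for x :: real
  have "f 0 < f x"
  proof (rule DERIV_pos_imp_increasing_open[OF assms(1)])
    fix y assume "0 < y" "y < x"
    thus "\<exists>d. (f has_real_derivative d) (at y) \<and> 0 < d"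
      using assms unfolding f_def
      by (intro exI[of _ "y * sin y"] conjI) (auto intro!: derivative_eq_intros mult_pos_pos sin_gt_zero)
  qed (auto simp: f_def intro!: continuous_intros)
  thus ?thesis by (simp add: f_def)
qed

text \<open>This is the sign condition for the derivative of (x / sin x)^2 cos x. The difference of
  the two sides vanishes at 0, and its derivative factors as sin y (2 (sin y - y cos y) + sin y),
  which is positive by \<open>x_cos_less_sin\<close>.\<close>

lemma two_sin_cos_less:
  fixes x :: real
  assumes "0 < x" "x \<le> pi / 2"
  shows "2 * sin x * cos x < x * (1 + (cos x)\<^sup>2)"
proof -
  define f where "f x = x * (1 + (cos x)\<^sup>2) - 2 * sin x * cos x" for x :: real
  have "f 0 < f x"
  proof (rule DERIV_pos_imp_increasing_open[OF assms(1)])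
    fix y assume y: "0 < y" "y < x"
    let ?d = "3 * (sin y)\<^sup>2 - 2 * y * sin y * cos y"
    have "(f has_real_derivative (1 + (cos y)\<^sup>2 - 2 * y * cos y * sin y - 2 * (cos y)\<^sup>2 + 2 * (sin y)\<^sup>2)) (at y)"
      unfolding f_def
      by (auto intro!: derivative_eq_intros simp: algebra_simps power2_eq_square)
    also have "1 + (cos y)\<^sup>2 - 2 * y * cos y * sin y - 2 * (cos y)\<^sup>2 + 2 * (sin y)\<^sup>2 = ?d"
      by (simp add: cos_squared_eq algebra_simps)
    finally have "(f has_real_derivative ?d) (at y)" .
    moreover have "0 < ?d"
    proof -
      have s: "0 < sin y" using y assms by (intro sin_gt_zero) auto
      hence "0 < sin y * (2 * (sin y - y * cos y) + sin y)"
        using x_cos_less_sin[of y] y assms by (intro mult_pos_pos add_pos_pos) auto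
      thus ?thesis by (simp add: algebra_simps power2_eq_square)
    qed
    ultimately show "\<exists>d. (f has_real_derivative d) (at y) \<and> 0 < d" by blast
  qed (auto simp: f_def intro!: continuous_intros)
  thus ?thesis by (simp add: f_def)
qed

text \<open>With t = pi/x, the derivative of cot (pi/x) in x is (t / sin t)^2 / pi, so this
  monotonicity is what makes cot (pi/x) concave.\<close>

lemma sin_over_less:
  fixes x y :: real
  assumes "0 < x" "x < y" "y \<le> pi / 2"
  shows "x / sin x < y / sin y"
proof (rule DERIV_pos_imp_increasing[OF assms(2)])
  fix z assume z: "x \<le> z" "z \<le> y"
  have s: "0 < sin z" using z assms by (intro sin_gt_zero) auto
  show "\<exists>d. ((\<lambda>z. z / sin z) has_real_derivative d) (at z) \<and> 0 < d"
    using s x_cos_less_sin[of z] z assms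
    by (intro exI[of _ "(sin z - z * cos z) / (sin z)\<^sup>2"] conjI)
      (auto intro!: derivative_eq_intros divide_pos_pos simp: power2_eq_square)
qed

text \<open>With t = pi/x, the derivative of 1 / sin (pi/x) in x is (t / sin t)^2 cos t / pi. As t
  falls when x grows, a decreasing function of t here means convexity in x.\<close>

lemma square_cos_over_less:
  fixes x y :: real
  assumes "0 < x" "x < y" "y \<le> pi / 2"
  shows "(y / sin y)\<^sup>2 * cos y < (x / sin x)\<^sup>2 * cos x"
proof (rule DERIV_neg_imp_decreasing[OF assms(2)])
  fix z assume z: "x \<le> z" "z \<le> y"
  have s: "0 < sin z" using z assms by (intro sin_gt_zero) auto
  let ?d = "2 * (z / sin z) * ((sin z - z * cos z) / (sin z)\<^sup>2) * cos z - (z / sin z)\<^sup>2 * sin z"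
  have "?d = (z / (sin z)^3) * (2 * sin z * cos z - z * (2 * (cos z)\<^sup>2 + (sin z)\<^sup>2))"
    using s by (simp add: field_simps power2_eq_square power3_eq_cube)
  also have "2 * (cos z)\<^sup>2 + (sin z)\<^sup>2 = 1 + (cos z)\<^sup>2" by (simp add: sin_squared_eq)
  also have "(z / (sin z)^3) * (2 * sin z * cos z - z * (1 + (cos z)\<^sup>2)) < 0"
    using two_sin_cos_less[of z] z assms s by (intro mult_pos_neg) auto
  finally have "?d < 0" .
  moreover have "((\<lambda>z. (z / sin z)\<^sup>2 * cos z) has_real_derivative ?d) (at z)"
    using s by (auto intro!: derivative_eq_intros simp: field_simps power2_eq_square)
  ultimately show "\<exists>d. ((\<lambda>z. (z / sin z)\<^sup>2 * cos z) has_real_derivative d) (at z) \<and> d < 0" by blast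
qed

text \<open>Strict concavity in the form used later: the mean value theorem on [x, x + h] and on
  [y, y + h] gives intermediate points u < x + h \<le> y < v.\<close>

lemma increment_less_of_deriv_antimono:
  fixes f f' :: "real \<Rightarrow> real"
  assumes deriv: "\<And>x. a \<le> x \<Longrightarrow> (f has_real_derivative f' x) (at x)"
    and anti: "\<And>x y. a \<le> x \<Longrightarrow> x < y \<Longrightarrow> f' y < f' x"
    and "a \<le> x" "0 < h" "x + h \<le> y"
  shows "f (y + h) - f y < f (x + h) - f x"
proof -
  obtain u where u: "x < u" "u < x + h" "f (x + h) - f x = h * f' u"
    using MVT2[of x "x + h" f f'] deriv assms by auto
  obtain v where v: "y < v" "v < y + h" "f (y + h) - f y = h * f' v"
    using MVT2[of y "y + h" f f'] deriv assms by auto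
  have "f' v < f' u" using u v assms by (intro anti) auto
  thus ?thesis using u v \<open>0 < h\<close> by simp
qed

lemma cot_pi_over_increment:
  fixes x y h :: real
  assumes "2 \<le> x" "0 < h" "x + h \<le> y"
  shows "cot (pi / (y + h)) - cot (pi / y) < cot (pi / (x + h)) - cot (pi / x)"
proof (rule increment_less_of_deriv_antimono[where f = "\<lambda>x. cot (pi / x)"
      and f' = "\<lambda>x. (pi / x / sin (pi / x))\<^sup>2 / pi", OF _ _ assms])
  fix x :: real assume "2 \<le> x"
  hence "0 < sin (pi / x)" by (intro sin_gt_zero) (auto simp: field_simps)
  moreover have "((\<lambda>x. pi / x) has_real_derivative - (pi / x\<^sup>2)) (at x)"
    using \<open>2 \<le> x\<close> by (auto intro!: derivative_eq_intros simp: power2_eq_square)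
  ultimately show "((\<lambda>x. cot (pi / x)) has_real_derivative (pi / x / sin (pi / x))\<^sup>2 / pi) (at x)"
    using \<open>2 \<le> x\<close>
    by (auto intro!: DERIV_cong[OF DERIV_chain2[OF DERIV_cot]] simp: field_simps power2_eq_square)
next
  fix x y :: real assume xy: "2 \<le> x" "x < y"
  have "pi / y / sin (pi / y) < pi / x / sin (pi / x)"
    using xy by (intro sin_over_less) (auto simp: field_simps)
  moreover have "0 < sin (pi / y)" using xy by (intro sin_gt_zero) (auto simp: field_simps)
  ultimately show "(pi / y / sin (pi / y))\<^sup>2 / pi < (pi / x / sin (pi / x))\<^sup>2 / pi"
    using xy by (intro divide_strict_right_mono power_strict_mono) auto
qed

lemma csc_pi_over_increment:
  fixes x y h :: real
  assumes "2 \<le> x" "0 < h" "x + h \<le> y"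
  shows "1 / sin (pi / (x + h)) - 1 / sin (pi / x) < 1 / sin (pi / (y + h)) - 1 / sin (pi / y)"
proof -
  \<comment> \<open>Convexity is obtained as concavity of the negated function.\<close>
  have "- (1 / sin (pi / (y + h))) - - (1 / sin (pi / y)) < - (1 / sin (pi / (x + h))) - - (1 / sin (pi / x))"
  proof (rule increment_less_of_deriv_antimono[where f = "\<lambda>x. - (1 / sin (pi / x))"
      and f' = "\<lambda>x. - ((pi / x / sin (pi / x))\<^sup>2 * cos (pi / x) / pi)", OF _ _ assms])
    fix x :: real assume "2 \<le> x"
    hence "0 < sin (pi / x)" by (intro sin_gt_zero) (auto simp: field_simps)
    thus "((\<lambda>x. - (1 / sin (pi / x))) has_real_derivative - ((pi / x / sin (pi / x))\<^sup>2 * cos (pi / x) / pi)) (at x)"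
      using \<open>2 \<le> x\<close> by (auto intro!: derivative_eq_intros simp: field_simps power2_eq_square)
  next
    fix x y :: real assume xy: "2 \<le> x" "x < y"
    have "(pi / x / sin (pi / x))\<^sup>2 * cos (pi / x) < (pi / y / sin (pi / y))\<^sup>2 * cos (pi / y)"
      using xy by (intro square_cos_over_less) (auto simp: field_simps)
    thus "- ((pi / y / sin (pi / y))\<^sup>2 * cos (pi / y) / pi) < - ((pi / x / sin (pi / x))\<^sup>2 * cos (pi / x) / pi)"
      by (simp add: divide_strict_right_mono)
  qed
  thus ?thesis by simp
qed

section \<open>Explicit expansions and their consequences\<close>

text \<open>After multiplication by \<open>x * sin x\<close>, Taylor bounds reduce both claims to
  polynomials whose difference is x^5 times a positive factor. The coefficient 1/30 leaves room
  above the true 1/45.\<close>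

lemma cot_bounds:
  fixes x :: real
  assumes "0 < x" "x \<le> 1"
  shows "cot x < 1 / x - x / 3" "cot x > 1 / x - x / 3 - x^3 / 30"
proof -
  have s: "0 < sin x" using assms pi_bounds by (intro sin_gt_zero) auto
  have x2: "x^2 \<le> 1" using assms by (simp add: power_le_one)
  have "x * cos x \<le> x * (1 - x^2/2 + x^4/24)"
    using assms cos_poly_bounds by (intro mult_left_mono) auto
  also have "\<dots> < (1 - x^2/3) * (x - x^3/6)"
  proof -
    have "(1 - x^2/3) * (x - x^3/6) - x * (1 - x^2/2 + x^4/24) = x^5 / 72"
      by (simp add: field_simps eval_nat_numeral)
    thus ?thesis using assms by (smt (verit) divide_pos_pos zero_less_power)
  qed
  also have "\<dots> \<le> (1 - x^2/3) * sin x"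
    using sin_poly_bounds(2)[of x] assms x2 by (intro mult_left_mono) auto
  finally show "cot x < 1 / x - x / 3"
    using assms s by (simp add: cot_def field_simps power2_eq_square)
  have "(1 - x^2/3 - x^4/30) * sin x \<le> (1 - x^2/3 - x^4/30) * (x - x^3/6 + x^5/120)"
    using sin_poly_bounds(1)[of x] assms x2 power_le_one[of x 4] by (intro mult_left_mono) auto
  also have "\<dots> < x * (1 - x^2/2 + x^4/24 - x^6/720)"
  proof -
    \<comment> \<open>The cofactor of x^5 is written with \<open>1 - x^2\<close> so that its
      positivity on (0, 1] is visible term by term.\<close>
    have "x * (1 - x^2/2 + x^4/24 - x^6/720) - (1 - x^2/3 - x^4/30) * (x - x^3/6 + x^5/120) =
      x^5 * (1/240 * (1 - x^2) + 1/144 + x^4 / 3600)"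
      by (simp add: field_simps eval_nat_numeral)
    moreover have "\<dots> > 0"
      using assms x2 by (intro mult_pos_pos add_pos_nonneg add_nonneg_pos) auto
    ultimately show ?thesis by (metis diff_gt_0_iff_gt)
  qed
  also have "\<dots> \<le> x * cos x"
    using assms cos_poly_bounds by (intro mult_left_mono) auto
  finally show "cot x > 1 / x - x / 3 - x^3 / 30"
    using assms s by (simp add: cot_def field_simps eval_nat_numeral)
qed

text \<open>The method is that of \<open>cot_bounds\<close>; the coefficient 1/40 exceeds the true
  7/360.\<close>

lemma csc_bounds:
  fixes x :: real
  assumes "0 < x" "x \<le> 1"
  shows "1 / sin x > 1 / x + x / 6" "1 / sin x < 1 / x + x / 6 + x^3 / 40"
proof -
  have s: "0 < sin x" using assms pi_bounds by (intro sin_gt_zero) auto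
  have x2: "x^2 \<le> 1" using assms by (simp add: power_le_one)
  have "(1 + x^2/6) * sin x \<le> (1 + x^2/6) * (x - x^3/6 + x^5/120)"
    using sin_poly_bounds(1)[of x] assms by (intro mult_left_mono) (auto intro: add_nonneg_nonneg)
  also have "\<dots> < x"
  proof -
    have "x - (1 + x^2/6) * (x - x^3/6 + x^5/120) = x^5 * (1/720 * (1 - x^2) + 13/720)"
      by (simp add: field_simps eval_nat_numeral)
    moreover have "\<dots> > 0"
      using assms x2 by (intro mult_pos_pos add_nonneg_pos) auto
    ultimately show ?thesis by (metis diff_gt_0_iff_gt)
  qed
  finally show "1 / sin x > 1 / x + x / 6"
    using assms s by (simp add: field_simps power2_eq_square)
  have "x < (1 + x^2/6 + x^4/40) * (x - x^3/6 + x^5/120 - x^7/5040)"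
  proof -
    have "(1 + x^2/6 + x^4/40) * (x - x^3/6 + x^5/120 - x^7/5040) - x =
      x^5 * (1/336 * (1 - x^2) + 13/5040 + x^4 * (1/201600 * (1 - x^2) + 103/604800))"
      by (simp add: field_simps eval_nat_numeral)
    moreover have "\<dots> > 0"
      using assms x2 by (intro mult_pos_pos add_pos_nonneg add_nonneg_pos mult_nonneg_nonneg add_nonneg_nonneg) auto
    ultimately show ?thesis by (metis diff_gt_0_iff_gt)
  qed
  also have "\<dots> \<le> (1 + x^2/6 + x^4/40) * sin x"
    using sin_poly_bounds(3)[of x] assms by (intro mult_left_mono) (auto intro: add_nonneg_nonneg)
  finally show "1 / sin x < 1 / x + x / 6 + x^3 / 40"
    using assms s by (simp add: field_simps eval_nat_numeral)
qed

text \<open>Serves to get exact values at pi/8 and pi/12. Where \<open>sin x = 0\<close>, both sides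
  are 0 by the convention for division by zero.\<close>

lemma cot_half_angle: "cot (x / 2) = (1 + cos x) / sin (x :: real)"
proof -
  have "cos x = 2 * (cos (x/2))\<^sup>2 - 1" "sin x = 2 * sin (x/2) * cos (x/2)"
    using cos_double_cos[of "x/2"] sin_double[of "x/2"] by simp_all
  thus ?thesis by (cases "cos (x/2) = 0") (auto simp: cot_def power2_eq_square)
qed

lemma cot_less_csc:
  fixes x :: real
  assumes "0 < x" "x < pi"
  shows "cot x < 1 / sin x"
proof -
  have "0 < sin x" using assms by (intro sin_gt_zero)
  moreover have "cos x < 1" using cos_monotone_0_pi[of 0 x] assms by simp
  ultimately show ?thesis by (simp add: cot_def divide_strict_right_mono)
qed

lemma csc_ge_inverse:
  fixes x :: real
  assumes "0 < x" "x < pi"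
  shows "1 / x \<le> 1 / sin x"
  using assms sin_x_le_x[of x] sin_gt_zero[of x] by (simp add: field_simps)

lemma cot_less_inverse:
  fixes x :: real
  assumes "0 < x" "x < pi"
  shows "cot x < 1 / x"
  using assms x_cos_less_sin[of x] sin_gt_zero[of x] by (simp add: cot_def field_simps)

text \<open>The additive function k / pi separates the two sides: it lies above cot (pi/k) and below
  1 / sin (pi/k).\<close>

lemma cot_less_csc_sum:
  fixes a b :: real
  assumes "a \<ge> 2" "b \<ge> 2"
  shows "cot (pi / (a + b)) < 1 / sin (pi / a) + 1 / sin (pi / b)"
proof -
  have "cot (pi / (a + b)) < 1 / (pi / (a + b))"
    using assms by (intro cot_less_inverse) (auto simp: divide_less_eq)
  also have "\<dots> = 1 / (pi / a) + 1 / (pi / b)" by (simp add: add_divide_distrib)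
  also have "\<dots> \<le> 1 / sin (pi / a) + 1 / sin (pi / b)"
    using assms by (intro add_mono csc_ge_inverse) (auto simp: field_simps)
  finally show ?thesis .
qed

lemma cot_pi_over_superadditive:
  fixes a b :: real
  assumes "a \<ge> 4" "b \<ge> 4"
  shows "cot (pi / a) + cot (pi / b) < cot (pi / (a + b))"
proof -
  define x y z where "x = pi / a" and "y = pi / b" and "z = pi / (a + b)"
  have x: "0 < x" "x \<le> 1" and y: "0 < y" "y \<le> 1" and z: "0 < z" "z < x" "z < y"
    using assms pi_bounds by (auto simp: x_def y_def z_def field_simps)
  have inv: "1 / z = 1 / x + 1 / y"
    by (simp add: x_def y_def z_def add_divide_distrib)
  have "z ^ 3 \<le> z" using x z power_decreasing[of 1 3 z] by simp
  thus ?thesis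
    using cot_bounds(1)[OF x] cot_bounds(1)[OF y] cot_bounds(2)[of z] x y z inv
    unfolding x_def[symmetric] y_def[symmetric] z_def[symmetric] by linarith
qed

lemma inverse_pi_bounds: "0.318309 < 1 / pi" "1 / pi < 0.318311"
  using pi_bounds by (simp_all add: field_simps)

lemma pi_cubed_less: "pi ^ 3 < 31.01"
proof -
  have "pi ^ 3 < 3.1416 ^ 3" using pi_bounds by (intro power_strict_mono) auto
  also have "\<dots> < 31.01" by (simp add: power_divide eval_nat_numeral)
  finally show ?thesis .
qed

lemma sqrt_2_3_bounds:
  "141421/100000 < sqrt 2" "sqrt 2 < 141422/100000" "173205/100000 < sqrt 3" "sqrt 3 < 173206/100000"
  by ((intro real_less_rsqrt real_less_lsqrt; simp add: power_divide)+)

text \<open>Rational bounds for pi/3 and pi^3/30 leave k / pi as the only term with pi, so that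
  later comparisons become linear arithmetic.\<close>

lemma cot_pi_over_bounds:
  fixes k :: real
  assumes "k \<ge> 4"
  shows "cot (pi / k) > k / pi - 10472/10000 * (1 / k) - 1034/1000 * (1 / k^3)"
    and "cot (pi / k) < k / pi - 1047/1000 * (1 / k)"
proof -
  have x: "0 < pi / k" "pi / k \<le> 1" using assms pi_bounds by auto
  have "pi / k / 3 < 10472/10000 * (1 / k)" "1047/1000 * (1 / k) < pi / k / 3" "(pi / k)^3 / 30 < 1034/1000 * (1 / k^3)"
    using assms pi_bounds pi_cubed_less by (auto simp: power_divide divide_simps)
  thus "cot (pi / k) > k / pi - 10472/10000 * (1 / k) - 1034/1000 * (1 / k^3)" "cot (pi / k) < k / pi - 1047/1000 * (1 / k)"
    using cot_bounds[OF x] by auto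
qed

lemma csc_pi_over_bounds:
  fixes k :: real
  assumes "k \<ge> 4"
  shows "1 / sin (pi / k) > k / pi + 5235/10000 * (1 / k)"
    and "1 / sin (pi / k) < k / pi + 5236/10000 * (1 / k) + 776/1000 * (1 / k^3)"
proof -
  have x: "0 < pi / k" "pi / k \<le> 1" using assms pi_bounds by auto
  have "5235/10000 * (1 / k) < pi / k / 6" "pi / k / 6 < 5236/10000 * (1 / k)" "(pi / k)^3 / 40 < 776/1000 * (1 / k^3)"
    using assms pi_bounds pi_cubed_less by (auto simp: power_divide divide_simps)
  thus "1 / sin (pi / k) > k / pi + 5235/10000 * (1 / k)" "1 / sin (pi / k) < k / pi + 5236/10000 * (1 / k) + 776/1000 * (1 / k^3)"
    using csc_bounds[OF x] by auto
qed

text \<open>The terms s / pi cancel and 2 / pi remains. At s = 16 the upper bounds add up to about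
  0.7315, while sqrt 3 - 1 is about 0.7320, so there is little slack.\<close>

lemma csc_minus_cot_less:
  fixes s :: real
  assumes "s \<ge> 16"
  shows "1 / sin (pi / (s + 2)) - cot (pi / s) < sqrt 3 - 1"
proof -
  have s: "4 \<le> s" "4 \<le> s + 2" using assms by auto
  have "2 / pi < 636622/1000000" using inverse_pi_bounds by simp
  moreover have "(s + 2) / pi = s / pi + 2 / pi" by (rule add_divide_distrib)
  moreover have "1 / (s + 2) \<le> 1 / 18" "1 / s \<le> 1 / 16" using assms by auto
  moreover have "1 / (s + 2)^3 \<le> 1 / 5832" "1 / s^3 \<le> 1 / 4096"
    using assms power_mono[of 18 "s + 2" 3] power_mono[of 16 s 3] by (simp_all add: divide_le_eq)
  ultimately show ?thesis
    using cot_pi_over_bounds(1)[OF s(1)] csc_pi_over_bounds(2)[OF s(2)] sqrt_2_3_bounds(3)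
    by linarith
qed

text \<open>Again 2 / pi remains; the correction terms lower it to no less than 0.545, well above
  sqrt 2 - 1.\<close>

lemma cot_minus_csc_greater:
  fixes s :: real
  assumes "s \<ge> 16"
  shows "sqrt 2 - 1 < cot (pi / (s + 2)) - 1 / sin (pi / s)"
proof -
  have s: "4 \<le> s" "4 \<le> s + 2" using assms by auto
  have "2 / pi > 636618/1000000" using inverse_pi_bounds by simp
  moreover have "(s + 2) / pi = s / pi + 2 / pi" by (rule add_divide_distrib)
  moreover have "1 / (s + 2) \<le> 1 / 18" "1 / s \<le> 1 / 16" using assms by auto
  moreover have "1 / (s + 2)^3 \<le> 1 / 5832" "1 / s^3 \<le> 1 / 4096"
    using assms power_mono[of 18 "s + 2" 3] power_mono[of 16 s 3] by (simp_all add: divide_le_eq)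
  ultimately show ?thesis
    using cot_pi_over_bounds(1)[OF s(2)] csc_pi_over_bounds(2)[OF s(1)] sqrt_2_3_bounds(2)
    by linarith
qed

section \<open>Exact values and enclosures for short cycles\<close>

text \<open>Closed forms are essential for the equalities in the final chain, where surds must
  cancel exactly.\<close>

lemma cot_pi_over_values:
  "cot (pi / 2) = 0" "cot (pi / 4) = 1" "cot (pi / 6) = sqrt 3"
  "cot (pi / 8) = sqrt 2 + 1" "cot (pi / 12) = sqrt 3 + 2"
  using cot_half_angle[of "pi / 4"] cot_half_angle[of "pi / 6"]
  by (simp_all add: cot_def sin_30 cos_30 sin_45 cos_45 add_divide_distrib real_div_sqrt)

lemma csc_pi_over_values:
  "1 / sin (pi / 2) = 1" "1 / sin (pi / 4) = sqrt 2" "1 / sin (pi / 6) = 2"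
  by (simp_all add: sin_30 sin_45 real_div_sqrt)

lemma cot_pi_over_numeric:
  "cot (pi / 10) \<in> {3.0773<..<3.0785}" "cot (pi / 14) \<in> {4.3811<..<4.3817}"
  "cot (pi / 16) \<in> {5.0272<..<5.0276}" "cot (pi / 18) \<in> {5.6711<..<5.6715}"
  "cot (pi / 20) \<in> {6.3136<..<6.314}"
  using cot_pi_over_bounds[of 10] cot_pi_over_bounds[of 14] cot_pi_over_bounds[of 16]
    cot_pi_over_bounds[of 18] cot_pi_over_bounds[of 20] inverse_pi_bounds
  by simp_all

lemma csc_pi_over_numeric:
  "1 / sin (pi / 8) \<in> {2.6119<..<2.6135}" "1 / sin (pi / 10) \<in> {3.2354<..<3.2363}"
  "1 / sin (pi / 12) \<in> {3.8633<..<3.864}" "1 / sin (pi / 14) \<in> {4.4937<..<4.4941}"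
  "1 / sin (pi / 16) \<in> {5.1256<..<5.1261}"
  using csc_pi_over_bounds[of 8] csc_pi_over_bounds[of 10] csc_pi_over_bounds[of 12]
    csc_pi_over_bounds[of 14] csc_pi_over_bounds[of 16] inverse_pi_bounds
  by simp_all
text \<open>Concavity with step 2: bringing two even lengths with fixed sum closer together raises
  the cotangent sum. The cosecant sum behaves the opposite way.\<close>

lemma cot_pi_over_pair_less:
  fixes a b :: nat
  assumes "2 \<le> a" "a + 2 \<le> b"
  shows "cot (pi / real a) + cot (pi / real (b + 2)) < cot (pi / real (a + 2)) + cot (pi / real b)"
  using cot_pi_over_increment[of a 2 b] assms by (simp add: add.commute)

lemma csc_pi_over_pair_less:
  fixes a b :: nat
  assumes "2 \<le> a" "a + 2 \<le> b"
  shows "1 / sin (pi / real (a + 2)) + 1 / sin (pi / real b) < 1 / sin (pi / real a) + 1 / sin (pi / real (b + 2))"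
  using csc_pi_over_increment[of a 2 b] assms by (simp add: add.commute)

section \<open>The chains\<close>

lemma M_eq: "M T = 2 * (T div 4)"
  unfolding M_def
proof (rule Greatest_equality)
  have "2 * (2 * (T div 4)) \<le> T" by presburger
  hence "real (2 * (2 * (T div 4))) \<le> real T" by (rule of_nat_mono)
  thus "even (2 * (T div 4)) \<and> real (2 * (T div 4)) \<le> real T / 2" by simp
next
  fix m assume m: "even m \<and> real m \<le> real T / 2"
  hence "real (2 * m) \<le> real T" by simp
  hence "2 * m \<le> T" by (simp only: of_nat_le_iff)
  moreover have "even m" using m ..
  ultimately show "m \<le> 2 * (T div 4)" by presburger
qed

lemma even_M: "even (M T)"
  by (simp add: M_eq)

lemma M_le: "2 * M T \<le> T"
  unfolding M_eq by presburger

lemma le_M: "even a \<Longrightarrow> 2 * a \<le> T \<Longrightarrow> a \<le> M T"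
  unfolding M_eq by presburger

lemma evens_empty [simp]: "u < l \<Longrightarrow> evens l u = []"
  by (simp add: evens_def)

text \<open>As \<open>u\<close> is even, \<open>u + 1\<close> is filtered out. The boundary case
  \<open>l = u + 2\<close> is included, where \<open>evens l u\<close> is empty.\<close>

lemma evens_snoc: "even u \<Longrightarrow> l \<le> u + 2 \<Longrightarrow> evens l (u + 2) = evens l u @ [u + 2]"
  by (cases "l = u + 2") (simp_all add: evens_def)

lemma evens_nonempty:
  assumes "even l" "l \<le> u"
  shows "evens l u \<noteq> []"
proof -
  have "l \<in> set (evens l u)" using assms by (simp add: evens_def del: upt_Suc)
  thus ?thesis by auto
qed

lemma hd_last_evens:
  assumes "even l" "even u" "l \<le> u"
  shows "hd (evens l u) = l" "last (evens l u) = u"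
proof -
  show "hd (evens l u) = l"
    using assms by (simp add: evens_def upt_conv_Cons del: upt_Suc)
  show "last (evens l u) = u"
    using assms by (simp add: evens_def)
qed

lemma successively_evens:
  assumes "even l" "even u" and "\<And>a. even a \<Longrightarrow> l \<le> a \<Longrightarrow> a + 2 \<le> u \<Longrightarrow> R a (a + 2)"
  shows "successively R (evens l u)"
proof -
  obtain j where u: "u = 2 * j" using assms by auto
  have "2 * i \<le> u \<Longrightarrow> successively R (evens l (2 * i))" for i
  proof (induction i)
    case 0
    show ?case by (auto simp: evens_def)
  next
    case (Suc i)
    show ?case
    proof (cases "l \<le> 2 * i")
      case True
      thus ?thesis
        using Suc assms(3)[of "2 * i"] assms(1) evens_snoc[of "2 * i" l]
        by (auto simp: successively_append_iff hd_last_evens)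
    next
      case False
      hence "l = 2 * i + 2 \<or> l > 2 * i + 2" using assms(1) by presburger
      thus ?thesis using evens_snoc[of "2 * i" l] by auto
    qed
  qed
  thus ?thesis using u by simp
qed

section \<open>Comparisons of energy sums\<close>

text \<open>One cycle of each length and sign is fixed with arbitrary individual arc signs; its
  energy depends only on the length and the product of the signs.\<close>

locale signed_cycle_families =
  fixes Cp Cm :: "nat \<Rightarrow> signed_digraph"
  assumes Cp: "\<And>k. k \<ge> 2 \<Longrightarrow> signed_cycle k 1 (Cp k)"
    and Cm: "\<And>k. k \<ge> 2 \<Longrightarrow> signed_cycle k (-1) (Cm k)"
begin

lemma E_Cp: "even k \<Longrightarrow> k \<ge> 2 \<Longrightarrow> E\<^sub>c (Cp k) = 2 * cot (pi / real k)"
  using iota_energy_positive_cycle[OF Cp] by simp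

lemma E_Cm: "even k \<Longrightarrow> k \<ge> 2 \<Longrightarrow> E\<^sub>c (Cm k) = 2 * (1 / sin (pi / real k))"
  using iota_energy_negative_cycle[OF Cm] by simp

lemma E_Cp_values:
  "E\<^sub>c (Cp 2) = 0" "E\<^sub>c (Cp 4) = 2" "E\<^sub>c (Cp 6) = 2 * sqrt 3" "E\<^sub>c (Cp 8) = 2 * sqrt 2 + 2"
  "E\<^sub>c (Cp 12) = 2 * sqrt 3 + 4"
  by (simp_all add: E_Cp cot_pi_over_values)

lemma E_Cm_values:
  "E\<^sub>c (Cm 2) = 2" "E\<^sub>c (Cm 4) = 2 * sqrt 2" "E\<^sub>c (Cm 6) = 4"
  by (simp_all add: E_Cm csc_pi_over_values del: divide_const_simps)

lemma energy_sum_Cp_less: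
  assumes "even T" "even a" "2 \<le> a" "2 * (a + 2) \<le> T"
  shows "energy_sum Cp T a < energy_sum Cp T (a + 2)"
proof -
  obtain b where b: "T = a + (b + 2)" "a + 2 \<le> b" "even b"
    using assms that[of "T - a - 2"] by auto
  have "T - a = b + 2" "T - (a + 2) = b" using b by auto
  thus ?thesis
    using cot_pi_over_pair_less[OF assms(3) b(2)] assms b unfolding energy_sum_def
    by (simp only: E_Cp even_add even_numeral)
qed

lemma energy_sum_Cm_less:
  assumes "even T" "even a" "2 \<le> a" "2 * (a + 2) \<le> T"
  shows "energy_sum Cm T (a + 2) < energy_sum Cm T a"
proof -
  obtain b where b: "T = a + (b + 2)" "a + 2 \<le> b" "even b"
    using assms that[of "T - a - 2"] by auto
  have "T - a = b + 2" "T - (a + 2) = b" using b by auto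
  thus ?thesis
    using csc_pi_over_pair_less[OF assms(3) b(2)] assms b unfolding energy_sum_def
    by (simp only: E_Cm even_add even_numeral)
qed

text \<open>Holds cycle by cycle, since cot < csc. It joins the initial run of negative sums to the
  first \<open>chain_B\<close>.\<close>

lemma energy_sum_Cp_less_Cm:
  assumes "even T" "even a" "2 \<le> a" "a + 2 \<le> T"
  shows "energy_sum Cp T a < energy_sum Cm T a"
proof -
  have *: "E\<^sub>c (Cp k) < E\<^sub>c (Cm k)" if "even k" "2 \<le> k" for k
  proof -
    have "cot (pi / real k) < 1 / sin (pi / real k)"
      using that by (intro cot_less_csc) (auto simp: field_simps)
    thus ?thesis using that by (simp add: E_Cp E_Cm)
  qed
  show ?thesis
    unfolding energy_sum_def using assms by (intro add_strict_mono *) auto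
qed

text \<open>The 2-cycle contributes cot (pi/2) = 0, so the left side is the single cotangent of
  \<open>cot_less_csc_sum\<close>. This is the last step inside \<open>chain_B\<close>.\<close>

lemma energy_sum_Cp_2_less_Cm:
  assumes "even T" "even a" "2 \<le> a" "a + 4 \<le> T"
  shows "energy_sum Cp T 2 < energy_sum Cm (T - 2) a"
proof -
  obtain b where b: "T = a + b + 2" "2 \<le> b" "even b"
    using assms that[of "T - a - 2"] by auto
  thus ?thesis
    using cot_less_csc_sum[of a b] assms cot_pi_over_values(1)
    by (simp add: energy_sum_def E_Cp E_Cm)
qed

text \<open>Superadditivity of cot (pi/k), with the vanishing energy of the positive 2-cycle. It
  links one \<open>chain_B\<close> to the next.\<close>

lemma energy_sum_Cp_less_Cp_2:
  assumes "even T" "even a" "4 \<le> a" "a + 6 \<le> T"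
  shows "energy_sum Cp (T - 2) a < energy_sum Cp T 2"
proof -
  obtain b where b: "T = a + b + 2" "4 \<le> b" "even b"
    using assms that[of "T - a - 2"] by auto
  thus ?thesis
    using cot_pi_over_superadditive[of a b] assms cot_pi_over_values(1)
    by (simp add: energy_sum_def E_Cp)
qed

text \<open>With \<open>s = T - 6\<close> only the lengths \<open>s\<close>, \<open>s + 2\<close>
  and 2, 4, 6 occur. The latter have exact energies, and T \<ge> 22 supplies the s \<ge> 16 of the
  two estimates.\<close>

lemma energy_sum_around_Cm_2:
  assumes "even T" "22 \<le> T"
  shows "energy_sum Cm (T - 2) 2 < energy_sum Cp T 6"
    and "energy_sum Cp T 4 < energy_sum Cm (T - 2) 2"
    and "energy_sum Cm (T - 2) 4 < energy_sum Cp T 4"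
proof -
  obtain s where s: "T = s + 6" "16 \<le> s" "even s"
    using assms that[of "T - 6"] by auto
  have d: "T - 2 - 2 = s + 2" "T - 6 = s" "T - 4 = s + 2" "T - 2 - 4 = s" using s by auto
  have "cot (pi / (real s + 2)) < 1 / sin (pi / (real s + 2))"
    by (intro cot_less_csc) (auto simp: field_simps add_pos_nonneg)
  moreover have "E\<^sub>c (Cp s) = 2 * cot (pi / real s)" "E\<^sub>c (Cm s) = 2 * (1 / sin (pi / real s))"
    "E\<^sub>c (Cp (s + 2)) = 2 * cot (pi / (real s + 2))"
    "E\<^sub>c (Cm (s + 2)) = 2 * (1 / sin (pi / (real s + 2)))"
    using s E_Cp[of s] E_Cm[of s] E_Cp[of "s + 2"] E_Cm[of "s + 2"] by (simp_all add: add.commute)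
  moreover have "1 / sin (pi / (real s + 2)) - cot (pi / real s) < sqrt 3 - 1"
    "sqrt 2 - 1 < cot (pi / (real s + 2)) - 1 / sin (pi / real s)"
    using s csc_minus_cot_less[of "real s"] cot_minus_csc_greater[of "real s"] by simp_all
  ultimately show "energy_sum Cm (T - 2) 2 < energy_sum Cp T 6"
    "energy_sum Cp T 4 < energy_sum Cm (T - 2) 2"
    "energy_sum Cm (T - 2) 4 < energy_sum Cp T 4"
    unfolding energy_sum_def d E_Cp_values E_Cm_values by linarith+
qed

section \<open>Assembling the chains\<close>

lemma chain_B_hd_last:
  assumes "even T" "22 \<le> T"
  shows "chain_B Cp Cm T \<noteq> []" "hd (chain_B Cp Cm T) = energy_sum Cp T (M T)"
    "last (chain_B Cp Cm T) = energy_sum Cp T 2"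
  using assms le_M[of 6 T] even_M evens_nonempty[of 6 "M T"]
  by (auto simp: chain_B_def hd_append hd_map hd_rev hd_last_evens)

lemma successively_chain_B:
  assumes T: "even T" "22 \<le> T"
  shows "successively (>) (chain_B Cp Cm T)"
proof -
  define m m' where "m = M T" and "m' = M (T - 2)"
  have m: "even m" "6 \<le> m" "2 * m \<le> T" and m': "even m'" "4 \<le> m'" "2 * m' \<le> T - 2"
    using T le_M[of 6 T] even_M M_le[of T] le_M[of 4 "T - 2"] M_le[of "T - 2"]
    by (auto simp: m_def m'_def)
  \<comment> \<open>The list ascends here; its reversal in \<open>chain_B\<close> turns this into a
    decreasing run.\<close>
  have "successively (\<lambda>a b. energy_sum Cp T a < energy_sum Cp T b) (evens 6 m)"
    using m T by (intro successively_evens energy_sum_Cp_less) auto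
  moreover have "successively (\<lambda>a b. energy_sum Cm (T - 2) a > energy_sum Cm (T - 2) b) (evens 4 m')"
    using m' T by (intro successively_evens energy_sum_Cm_less) auto
  moreover have "energy_sum Cp T 2 < energy_sum Cm (T - 2) m'"
    using m' T by (intro energy_sum_Cp_2_less_Cm) auto
  ultimately show ?thesis
    using energy_sum_around_Cm_2[OF T] m m' evens_nonempty[of 6 m] evens_nonempty[of 4 m']
    by (auto simp: chain_B_def successively_append_iff successively_map successively_Cons
        hd_append hd_map last_map last_rev hd_last_evens simp flip: m_def m'_def)
qed

text \<open>The head is carried through the induction because prepending the next block requires
  comparing its last element with the head of what follows.\<close>

lemma successively_concat_chain_B:
  "successively (>) (concat (map (chain_B Cp Cm) (rev (evens 22 (22 + 2 * i)))))"
  "hd (concat (map (chain_B Cp Cm) (rev (evens 22 (22 + 2 * i))))) =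
     energy_sum Cp (22 + 2 * i) (M (22 + 2 * i))"
proof (induction i)
  case 0
  have "evens 22 22 = [22]" by (simp add: evens_def)
  thus "successively (>) (concat (map (chain_B Cp Cm) (rev (evens 22 (22 + 2 * 0)))))"
    and "hd (concat (map (chain_B Cp Cm) (rev (evens 22 (22 + 2 * 0))))) =
      energy_sum Cp (22 + 2 * 0) (M (22 + 2 * 0))"
    using successively_chain_B[of 22] chain_B_hd_last[of 22] by auto
next
  case (Suc i)
  define T where "T = 22 + 2 * i"
  define m where "m = M T"
  define rest where "rest = concat (map (chain_B Cp Cm) (rev (evens 22 T)))"
  have T: "even T" "22 \<le> T" "22 + 2 * Suc i = T + 2" by (auto simp: T_def)
  have rest: "concat (map (chain_B Cp Cm) (rev (evens 22 (T + 2)))) = chain_B Cp Cm (T + 2) @ rest"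
    using T(1,2) by (simp only: evens_snoc rest_def) simp
  have "even m" "4 \<le> m" "2 * m \<le> T"
    using T(1,2) le_M[of 4 T] even_M M_le[of T] by (simp_all add: m_def)
  hence "energy_sum Cp (T + 2 - 2) m < energy_sum Cp (T + 2) 2"
    using T(1,2) by (intro energy_sum_Cp_less_Cp_2) simp_all
  hence "hd rest < energy_sum Cp (T + 2) 2"
    using Suc(2) by (simp add: rest_def m_def T_def)
  moreover have "successively (>) rest"
    using Suc(1) by (simp add: rest_def T_def)
  ultimately show "successively (>) (concat (map (chain_B Cp Cm) (rev (evens 22 (22 + 2 * Suc i)))))"
    and "hd (concat (map (chain_B Cp Cm) (rev (evens 22 (22 + 2 * Suc i))))) =
      energy_sum Cp (22 + 2 * Suc i) (M (22 + 2 * Suc i))"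
    unfolding T(3) rest
    using successively_chain_B[of "T + 2"] chain_B_hd_last[of "T + 2"] T(1,2)
    by (simp_all add: successively_append_iff)
qed

lemma successively_full_chain:
  assumes N: "even N" "22 \<le> N"
  shows "successively (>)
    (map (energy_sum Cm N) (evens 2 (M N)) @ concat (map (chain_B Cp Cm) (rev (evens 22 N))))"
proof -
  have "N = 22 + 2 * (N div 2 - 11)" using N by presburger
  then obtain i where i: "N = 22 + 2 * i" ..
  have M: "even (M N)" "2 \<le> M N" "2 * M N \<le> N"
    using N le_M[of 2 N] even_M M_le[of N] by auto
  have "successively (\<lambda>a b. energy_sum Cm N a > energy_sum Cm N b) (evens 2 (M N))"
    using M N by (intro successively_evens energy_sum_Cm_less) auto
  moreover have "energy_sum Cp N (M N) < energy_sum Cm N (M N)"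
    using M N by (intro energy_sum_Cp_less_Cm) auto
  ultimately show ?thesis
    using successively_concat_chain_B[of i] M evens_nonempty[of 2 "M N"] unfolding i[symmetric]
    by (auto simp: successively_append_iff successively_map last_map hd_last_evens)
qed

text \<open>Scaling by 10000 gives integer bounds, convenient for linear arithmetic.\<close>

lemma E_Cp_numeric:
  "61546 < 10000 * E\<^sub>c (Cp 10)" "10000 * E\<^sub>c (Cp 10) < 61570"
  "87622 < 10000 * E\<^sub>c (Cp 14)" "10000 * E\<^sub>c (Cp 14) < 87634"
  "100544 < 10000 * E\<^sub>c (Cp 16)" "10000 * E\<^sub>c (Cp 16) < 100552"
  "113422 < 10000 * E\<^sub>c (Cp 18)" "10000 * E\<^sub>c (Cp 18) < 113430"
  "126272 < 10000 * E\<^sub>c (Cp 20)" "10000 * E\<^sub>c (Cp 20) < 126280"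
  using cot_pi_over_numeric by (simp_all add: E_Cp)

lemma E_Cm_numeric:
  "52238 < 10000 * E\<^sub>c (Cm 8)" "10000 * E\<^sub>c (Cm 8) < 52270"
  "64708 < 10000 * E\<^sub>c (Cm 10)" "10000 * E\<^sub>c (Cm 10) < 64726"
  "77266 < 10000 * E\<^sub>c (Cm 12)" "10000 * E\<^sub>c (Cm 12) < 77280"
  "89874 < 10000 * E\<^sub>c (Cm 14)" "10000 * E\<^sub>c (Cm 14) < 89882"
  "102512 < 10000 * E\<^sub>c (Cm 16)" "10000 * E\<^sub>c (Cm 16) < 102522"
  using csc_pi_over_numeric by (simp_all add: E_Cm)

end

theorem theorem3p3:
  fixes Cp Cm :: "nat \<Rightarrow> signed_digraph"
  assumes "\<And>k. k \<ge> 2 \<Longrightarrow> signed_cycle k 1 (Cp k)"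
    and "\<And>k. k \<ge> 2 \<Longrightarrow> signed_cycle k (-1) (Cm k)"
  shows "(\<forall>n\<ge>22. let N = (if even n then n else n - 1) in
           successively (>)
             (map (energy_sum Cm N) (evens 2 (M N)) @
              concat (map (chain_B Cp Cm) (rev (evens 22 N)))))
    \<and> (E\<^sub>c (Cp 2) + E\<^sub>c (Cp 20) > E\<^sub>c (Cp 10) + E\<^sub>c (Cp 10) \<and>
       E\<^sub>c (Cp 10) + E\<^sub>c (Cp 10) > E\<^sub>c (Cp 8) + E\<^sub>c (Cp 12) \<and>
       E\<^sub>c (Cp 8) + E\<^sub>c (Cp 12) > E\<^sub>c (Cm 2) + E\<^sub>c (Cm 16) \<and>
       E\<^sub>c (Cm 2) + E\<^sub>c (Cm 16) > E\<^sub>c (Cp 6) + E\<^sub>c (Cp 14) \<and>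
       E\<^sub>c (Cp 6) + E\<^sub>c (Cp 14) > E\<^sub>c (Cp 4) + E\<^sub>c (Cp 16) \<and>
       E\<^sub>c (Cp 4) + E\<^sub>c (Cp 16) > E\<^sub>c (Cm 4) + E\<^sub>c (Cm 14) \<and>
       E\<^sub>c (Cm 4) + E\<^sub>c (Cm 14) > E\<^sub>c (Cm 6) + E\<^sub>c (Cm 12) \<and>
       E\<^sub>c (Cm 6) + E\<^sub>c (Cm 12) > E\<^sub>c (Cm 8) + E\<^sub>c (Cm 10) \<and>
       E\<^sub>c (Cm 8) + E\<^sub>c (Cm 10) > E\<^sub>c (Cp 2) + E\<^sub>c (Cp 18) \<and>
       E\<^sub>c (Cp 2) + E\<^sub>c (Cp 18) > E\<^sub>c (Cm 2) + E\<^sub>c (Cm 14) \<and>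
       E\<^sub>c (Cm 2) + E\<^sub>c (Cm 14) > E\<^sub>c (Cp 8) + E\<^sub>c (Cp 10) \<and>
       E\<^sub>c (Cp 8) + E\<^sub>c (Cp 10) > E\<^sub>c (Cp 6) + E\<^sub>c (Cp 12) \<and>
       E\<^sub>c (Cp 6) + E\<^sub>c (Cp 12) > E\<^sub>c (Cp 4) + E\<^sub>c (Cp 14) \<and>
       E\<^sub>c (Cp 4) + E\<^sub>c (Cp 14) > E\<^sub>c (Cm 4) + E\<^sub>c (Cm 12) \<and>
       E\<^sub>c (Cm 4) + E\<^sub>c (Cm 12) > E\<^sub>c (Cm 6) + E\<^sub>c (Cm 10) \<and>
       E\<^sub>c (Cm 6) + E\<^sub>c (Cm 10) > E\<^sub>c (Cm 8) + E\<^sub>c (Cm 8) \<and>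
       E\<^sub>c (Cm 8) + E\<^sub>c (Cm 8) > E\<^sub>c (Cp 2) + E\<^sub>c (Cp 16) \<and>
       E\<^sub>c (Cp 2) + E\<^sub>c (Cp 16) > E\<^sub>c (Cm 2) + E\<^sub>c (Cm 12) \<and>
       E\<^sub>c (Cm 2) + E\<^sub>c (Cm 12) > E\<^sub>c (Cp 8) + E\<^sub>c (Cp 8) \<and>
       E\<^sub>c (Cp 8) + E\<^sub>c (Cp 8) > E\<^sub>c (Cp 6) + E\<^sub>c (Cp 10) \<and>
       E\<^sub>c (Cp 6) + E\<^sub>c (Cp 10) > E\<^sub>c (Cp 4) + E\<^sub>c (Cp 12) \<and>
       E\<^sub>c (Cp 4) + E\<^sub>c (Cp 12) > E\<^sub>c (Cm 4) + E\<^sub>c (Cm 10) \<and>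
       E\<^sub>c (Cm 4) + E\<^sub>c (Cm 10) > E\<^sub>c (Cm 6) + E\<^sub>c (Cm 8) \<and>
       E\<^sub>c (Cm 6) + E\<^sub>c (Cm 8) > E\<^sub>c (Cp 2) + E\<^sub>c (Cp 14) \<and>
       E\<^sub>c (Cp 2) + E\<^sub>c (Cp 14) > E\<^sub>c (Cm 2) + E\<^sub>c (Cm 10) \<and>
       E\<^sub>c (Cm 2) + E\<^sub>c (Cm 10) > E\<^sub>c (Cp 6) + E\<^sub>c (Cp 8) \<and>
       E\<^sub>c (Cp 6) + E\<^sub>c (Cp 8) > E\<^sub>c (Cp 4) + E\<^sub>c (Cp 10) \<and>
       E\<^sub>c (Cp 4) + E\<^sub>c (Cp 10) > E\<^sub>c (Cm 4) + E\<^sub>c (Cm 8) \<and>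
       E\<^sub>c (Cm 4) + E\<^sub>c (Cm 8) > E\<^sub>c (Cm 6) + E\<^sub>c (Cm 6) \<and>
       E\<^sub>c (Cm 6) + E\<^sub>c (Cm 6) > E\<^sub>c (Cp 2) + E\<^sub>c (Cp 12) \<and>
       E\<^sub>c (Cp 2) + E\<^sub>c (Cp 12) > E\<^sub>c (Cm 2) + E\<^sub>c (Cm 8) \<and>
       E\<^sub>c (Cm 2) + E\<^sub>c (Cm 8) > E\<^sub>c (Cp 6) + E\<^sub>c (Cp 6) \<and>
       E\<^sub>c (Cp 6) + E\<^sub>c (Cp 6) > E\<^sub>c (Cp 4) + E\<^sub>c (Cp 8) \<and>
       E\<^sub>c (Cp 4) + E\<^sub>c (Cp 8) = E\<^sub>c (Cm 4) + E\<^sub>c (Cm 6) \<and>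
       E\<^sub>c (Cm 4) + E\<^sub>c (Cm 6) > E\<^sub>c (Cp 2) + E\<^sub>c (Cp 10) \<and>
       E\<^sub>c (Cp 2) + E\<^sub>c (Cp 10) > E\<^sub>c (Cm 2) + E\<^sub>c (Cm 6) \<and>
       E\<^sub>c (Cm 2) + E\<^sub>c (Cm 6) > E\<^sub>c (Cm 4) + E\<^sub>c (Cm 4) \<and>
       E\<^sub>c (Cm 4) + E\<^sub>c (Cm 4) > E\<^sub>c (Cp 4) + E\<^sub>c (Cp 6) \<and>
       E\<^sub>c (Cp 4) + E\<^sub>c (Cp 6) > E\<^sub>c (Cp 2) + E\<^sub>c (Cp 8) \<and>
       E\<^sub>c (Cp 2) + E\<^sub>c (Cp 8) = E\<^sub>c (Cm 2) + E\<^sub>c (Cm 4) \<and>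
       E\<^sub>c (Cm 2) + E\<^sub>c (Cm 4) > E\<^sub>c (Cp 4) + E\<^sub>c (Cp 4) \<and>
       E\<^sub>c (Cp 4) + E\<^sub>c (Cp 4) = E\<^sub>c (Cm 2) + E\<^sub>c (Cm 2) \<and>
       E\<^sub>c (Cm 2) + E\<^sub>c (Cm 2) > E\<^sub>c (Cp 2) + E\<^sub>c (Cp 6) \<and>
       E\<^sub>c (Cp 2) + E\<^sub>c (Cp 6) > E\<^sub>c (Cp 2) + E\<^sub>c (Cp 4) \<and>
       E\<^sub>c (Cp 2) + E\<^sub>c (Cp 4) > E\<^sub>c (Cp 2) + E\<^sub>c (Cp 2))"
proof -
  interpret signed_cycle_families Cp Cm
    by (rule signed_cycle_families.intro) (fact assms)+
  show ?thesis
  proof (rule conjI, goal_cases)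
    case 1
    \<comment> \<open>An odd n \<ge> 22 is at least 23, so n - 1 is still at least 22.\<close>
    have N: "even (if even n then n else n - 1) \<and> 22 \<le> (if even n then n else n - 1)" if "n \<ge> 22" for n :: nat
    proof (cases "even n")
      case False
      hence "n \<noteq> 22" by auto
      thus ?thesis using False that by simp
    qed (use that in simp)
    show ?case
      unfolding Let_def
      by (intro allI impI successively_full_chain conjunct1[OF N] conjunct2[OF N])
  next
    case 2
    show ?case
      \<comment> \<open>The equalities are identities between the exact values. The narrowest strict
        comparison is \<open>Cm 2\<close>, \<open>Cm 14\<close> against \<open>Cp 8\<close>,
        \<open>Cp 10\<close>, with a gap of about 0.004, which the enclosures resolve.\<close>
      unfolding E_Cp_values E_Cm_values
      using E_Cp_numeric E_Cm_numeric sqrt_2_3_bounds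
      by (intro conjI) linarith+
  qed
qed

end
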